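(* Let $A_0,K\in UT_2(\mathbb{Z})$ and put $N=K^2-A_0^2$. Assume that $3A_0+2K\neq 0$, $A_0+K\neq 0$ and $5A_0+4K\neq 0$, and that either $\operatorname{tr}(2A_0+K)\neq 0$, or $\operatorname{tr}(A_0)=\operatorname{tr}(K)=0$. For $t\in\mathbb{Z}$ let $U_t=\begin{pmatrix}0&t\\0&0\end{pmatrix}$. Then there exist infinitely many $t\in\mathbb{Z}\setminus\{0\}$ such that $$\{A_0+U_t,\ A_0-U_t,\ 2A_0+2K,\ 5A_0+4K\}$$ is a Jordan $D(N)$-quadruple in $UT_2(\mathbb{Z})$.
   Context: $UT_2(\mathbb{Z})$ denotes the ring of upper-triangular $2\times 2$ integer matrices, and $A\circ B=\frac12(AB+BA)$ (computed over $\mathbb{Q}$) is the Jordan product. For $N\in UT_2(\mathbb{Z})$, a Jordan $D(N)$-quadruple in $UT_2(\mathbb{Z})$ is a set of four distinct nonzero matrices $A_1,A_2,A_3,A_4\in UT_2(\mathbb{Z})$ such that for every $1\le i<j\le 4$ there exists $X_{ij}\in UT_2(\mathbb{Z})$ with $A_i\circ A_j+N=X_{ij}^2$. *)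

theory Defs
  imports "HOL-Analysis.Analysis"
begin

text \<open>
  The product of matrices is \<open>**\<close> throughout: on \<open>'a^2^2\<close> the operations \<open>*\<close> and \<open>^\<close> of the
  type classes are entrywise.
\<close>

definition mat_scale :: "'a::times \<Rightarrow> 'a^'n^'m \<Rightarrow> 'a^'n^'m"  (infixr \<open>\<odot>\<close> 75) where
  "c \<odot> A = map_matrix ((*) c) A"

text \<open>
  Rows and columns are indexed by \<open>1\<close> and \<open>2\<close>. In the index type \<open>2\<close> we have \<open>2 = 0 < 1\<close>, so
  upper triangularity is not expressed through the order of the indices.
\<close>

definition UT2 :: "(int^2^2) set" where
  "UT2 = {A. A $ 2 $ 1 = 0}"

definition jordan_prod :: "rat^2^2 \<Rightarrow> rat^2^2 \<Rightarrow> rat^2^2"  (infixl \<open>\<circ>\<^sub>J\<close> 70) where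
  "A \<circ>\<^sub>J B = (1/2) \<odot> (A ** B + B ** A)"

abbreviation rat_mat :: "int^2^2 \<Rightarrow> rat^2^2" where
  "rat_mat \<equiv> map_matrix of_int"

text \<open>
  Since the Jordan product is commutative, ranging over ordered pairs of distinct elements is the
  same as ranging over index pairs \<open>i < j\<close> in an enumeration of \<open>S\<close>.
\<close>

definition jordan_D_quadruple :: "int^2^2 \<Rightarrow> (int^2^2) set \<Rightarrow> bool" where
  "jordan_D_quadruple N S \<longleftrightarrow>
     card S = 4 \<and> S \<subseteq> UT2 \<and> 0 \<notin> S \<and>
     (\<forall>A\<in>S. \<forall>B\<in>S. A \<noteq> B \<longrightarrow>
        (\<exists>X\<in>UT2. rat_mat A \<circ>\<^sub>J rat_mat B + rat_mat N = rat_mat (X ** X)))"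

definition U :: "int \<Rightarrow> int^2^2" where
  "U t = vector [vector [0, t], vector [0, 0]]"

end

theory Submission
  imports Defs
begin

text \<open>
  Doubling the Jordan product clears the denominator, so every condition on a pair \<open>A, B\<close> becomes
  the integer equation \<open>AB + BA + 2N = 2X\<^sup>2\<close>. For \<open>t = 0\<close> all of these are identities: modulo
  \<open>N = K\<^sup>2 - A\<^sub>0\<^sup>2\<close>, the products of \<open>A\<^sub>0\<close> with \<open>A\<^sub>0\<close>, \<open>2A\<^sub>0 + 2K\<close> and \<open>5A\<^sub>0 + 4K\<close> are completed
  to the squares of \<open>K\<close>, \<open>A\<^sub>0 + K\<close> and \<open>2A\<^sub>0 + K\<close>, and the product of the last two matrices to the
  square of \<open>3(A\<^sub>0 + K)\<close>.

  Replacing one copy of \<open>A\<^sub>0\<close> by \<open>A\<^sub>0 + U\<^sub>t\<close> and the other by \<open>A\<^sub>0 - U\<^sub>t\<close> keeps the solution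
  valid, because \<open>U\<^sub>t\<close> is nilpotent and, for upper triangular \<open>Y\<close>, \<open>YU\<^sub>t + U\<^sub>tY\<close> is \<open>U\<^sub>t\<close> scaled
  by \<open>tr Y\<close> (lemma \<open>UT2_anticommutator_U\<close>). Thus moving a factor by \<open>U\<^sub>t\<close> only disturbs the
  corner entry, and moving the root by a suitable \<open>U\<^sub>s\<close> repairs it, provided one linear equation
  for \<open>s\<close> is solvable (lemma \<open>completes_square_perturb\<close>). Against \<open>2A\<^sub>0 + 2K\<close> one may take
  \<open>s = t\<close>. Against \<open>5A\<^sub>0 + 4K\<close> the equation is \<open>2s tr(2A\<^sub>0 + K) = t tr(5A\<^sub>0 + 4K)\<close>: if
  \<open>tr(2A\<^sub>0 + K) \<noteq> 0\<close> it is solvable for all multiples \<open>t\<close> of \<open>2 tr(2A\<^sub>0 + K)\<close>, and if both traces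
  vanish it is solvable for every \<open>t\<close>. Finally, each coincidence between the four
  matrices, or of one of them with zero, either is excluded by hypothesis or prescribes \<open>U\<^sub>t\<close>, so
  only finitely many \<open>t\<close> are lost.
\<close>

definition completes_square :: "int^2^2 \<Rightarrow> int^2^2 \<Rightarrow> int^2^2 \<Rightarrow> int^2^2 \<Rightarrow> bool" where
  "completes_square N A B X \<longleftrightarrow> A ** B + B ** A + 2 \<odot> N = 2 \<odot> (X ** X)"

lemmas mat2_entries =
  vec_eq_iff forall_2 sum_2 matrix_matrix_mult_def mat_scale_def map_matrix_def U_def trace_def
  UT2_def

lemma completes_square_imp_rat:
  assumes "completes_square N A B X"
  shows "rat_mat A \<circ>\<^sub>J rat_mat B + rat_mat N = rat_mat (X ** X)"
proof -
  have "(A ** B) $ i $ j + (B ** A) $ i $ j + 2 * N $ i $ j = 2 * (X ** X) $ i $ j" for i j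
    using assms by (auto simp: completes_square_def vec_eq_iff mat_scale_def map_matrix_def)
  then have entry: "rat_of_int ((A ** B) $ i $ j) + rat_of_int ((B ** A) $ i $ j)
      + 2 * rat_of_int (N $ i $ j) = 2 * rat_of_int ((X ** X) $ i $ j)" for i j
    by (metis of_int_add of_int_mult of_int_numeral)
  have rat_mult: "(rat_mat P ** rat_mat Q) $ i $ j = rat_of_int ((P ** Q) $ i $ j)" for P Q i j
    by (simp add: matrix_matrix_mult_def map_matrix_def)
  show ?thesis
    unfolding vec_eq_iff
  proof (intro allI)
    fix i j
    have "(rat_mat A \<circ>\<^sub>J rat_mat B + rat_mat N) $ i $ j
        = (rat_of_int ((A ** B) $ i $ j) + rat_of_int ((B ** A) $ i $ j)) / 2
          + rat_of_int (N $ i $ j)"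
      by (simp add: jordan_prod_def mat_scale_def rat_mult map_matrix_def[of "(*) (1/2)"]
          map_matrix_def[of of_int N] add_divide_distrib)
    also have "\<dots> = rat_of_int ((X ** X) $ i $ j)"
      using entry[of i j] by (simp add: field_simps)
    finally show "(rat_mat A \<circ>\<^sub>J rat_mat B + rat_mat N) $ i $ j = rat_mat (X ** X) $ i $ j"
      by (simp add: map_matrix_def)
  qed
qed

lemma completes_square_commute: "completes_square N A B X \<longleftrightarrow> completes_square N B A X"
  by (simp add: completes_square_def add.commute)

lemma jordan_D_quadrupleI:
  assumes "distinct [A, B, C, D]" and "{A, B, C, D} \<subseteq> UT2" and "0 \<notin> {A, B, C, D}"
    and "\<exists>X\<in>UT2. completes_square N A B X" and "\<exists>X\<in>UT2. completes_square N A C X"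
    and "\<exists>X\<in>UT2. completes_square N A D X" and "\<exists>X\<in>UT2. completes_square N B C X"
    and "\<exists>X\<in>UT2. completes_square N B D X" and "\<exists>X\<in>UT2. completes_square N C D X"
  shows "jordan_D_quadruple N {A, B, C, D}"
proof -
  define R where "R P Q \<longleftrightarrow> (\<exists>X\<in>UT2. completes_square N P Q X)" for P Q
  have R_sym: "R Q P" if "R P Q" for P Q
    using that completes_square_commute unfolding R_def by blast
  have "R A B" "R A C" "R A D" "R B C" "R B D" "R C D"
    using assms(4-9) by (simp_all only: R_def)
  then have "\<forall>P\<in>{A, B, C, D}. \<forall>Q\<in>{A, B, C, D}. P \<noteq> Q \<longrightarrow> R P Q"
    by (simp add: R_sym)
  then have "\<forall>P\<in>{A, B, C, D}. \<forall>Q\<in>{A, B, C, D}. P \<noteq> Q \<longrightarrow>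
      (\<exists>X\<in>UT2. rat_mat P \<circ>\<^sub>J rat_mat Q + rat_mat N = rat_mat (X ** X))"
    unfolding R_def using completes_square_imp_rat by blast
  moreover have "card {A, B, C, D} = 4"
    using distinct_card[OF assms(1)] by simp
  ultimately show ?thesis
    using assms(2,3) by (simp only: jordan_D_quadruple_def) blast
qed

lemma UT2_closed:
  shows UT2_add: "A \<in> UT2 \<Longrightarrow> B \<in> UT2 \<Longrightarrow> A + B \<in> UT2"
    and UT2_diff: "A \<in> UT2 \<Longrightarrow> B \<in> UT2 \<Longrightarrow> A - B \<in> UT2"
    and UT2_scale: "A \<in> UT2 \<Longrightarrow> c \<odot> A \<in> UT2"
    and UT2_U: "U t \<in> UT2"
  by (auto simp: mat2_entries)

lemma U_minus: "U (- t) = - U t"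
  by (simp add: mat2_entries)

lemma inj_U: "inj U"
  by (auto simp: inj_def mat2_entries)

lemma matrix_add_rdistrib: "(A + B) ** C = A ** C + B ** C"
  by (simp add: vec_eq_iff matrix_matrix_mult_def distrib_right sum.distrib)

lemma U_mult_U: "U s ** U t = 0"
  by (simp add: mat2_entries)

lemma UT2_anticommutator_U:
  assumes "Y \<in> UT2"
  shows "Y ** U t + U t ** Y = U (t * trace Y)"
  using assms by (simp add: mat2_entries algebra_simps)

text \<open>
  To first order, the doubled left-hand side moves by \<open>t tr C\<close> in the corner and the doubled square
  by \<open>2s tr Y\<close>; the second-order term of the square vanishes since \<open>U\<^sub>s\<close> squares to zero.
\<close>

lemma completes_square_perturb:
  assumes "C \<in> UT2" and "Y \<in> UT2"
    and base: "completes_square N A C Y"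
    and balance: "2 * s * trace Y = t * trace C"
  shows "completes_square N (A + U t) C (Y + U s)"
proof -
  have "(A + U t) ** C + C ** (A + U t) + 2 \<odot> N
      = (A ** C + C ** A + 2 \<odot> N) + (C ** U t + U t ** C)"
    by (simp add: matrix_add_ldistrib matrix_add_rdistrib)
  also have "\<dots> = 2 \<odot> (Y ** Y) + U (2 * s * trace Y)"
    using base balance \<open>C \<in> UT2\<close> by (simp add: completes_square_def UT2_anticommutator_U)
  also have "\<dots> = 2 \<odot> (Y ** Y + (Y ** U s + U s ** Y))"
    unfolding UT2_anticommutator_U[OF \<open>Y \<in> UT2\<close>]
    by (simp add: vec_eq_iff forall_2 U_def mat_scale_def map_matrix_def)
  also have "Y ** Y + (Y ** U s + U s ** Y) = (Y + U s) ** (Y + U s)"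
    by (simp add: matrix_add_ldistrib matrix_add_rdistrib U_mult_U)
  finally show ?thesis
    by (simp add: completes_square_def)
qed

lemma completes_square_identities:
  fixes A K :: "int^2^2"
  defines "N \<equiv> K ** K - A ** A"
  shows "completes_square N A (2 \<odot> A + 2 \<odot> K) (A + K)"
    and "completes_square N A (5 \<odot> A + 4 \<odot> K) (2 \<odot> A + K)"
    and "completes_square N (2 \<odot> A + 2 \<odot> K) (5 \<odot> A + 4 \<odot> K) (3 \<odot> (A + K))"
  unfolding N_def completes_square_def
  by (simp_all add: mat2_entries algebra_simps)

text \<open>
  The cross terms cancel in the symmetrised product of \<open>A + U\<^sub>t\<close> and \<open>A - U\<^sub>t\<close>, so \<open>t\<close> disappears.
\<close>

lemma completes_square_conjugates:
  "completes_square (K ** K - A ** A) (A + U t) (A - U t) K"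
  unfolding completes_square_def
  by (simp add: mat2_entries algebra_simps)

text \<open>
  With \<open>y\<close> the trace of the root and \<open>d\<close> that of the unperturbed factor, this is the supply of
  parameters for lemma \<open>completes_square_perturb\<close>.
\<close>

lemma infinite_repairable:
  fixes y d :: int
  assumes "y \<noteq> 0 \<or> d = 0"
  shows "infinite {t. \<exists>s. 2 * s * y = t * d}"
proof (cases "y = 0")
  case True
  then show ?thesis using assms infinite_UNIV_int by simp
next
  case False
  have "range (\<lambda>n. 2 * y * n) \<subseteq> {t. \<exists>s. 2 * s * y = t * d}"
  proof clarify
    fix n
    have "2 * (n * d) * y = 2 * y * n * d" by simp
    then show "\<exists>s. 2 * s * y = 2 * y * n * d" by blast
  qed
  moreover have "infinite (range (\<lambda>n. 2 * y * n))"
    using False by (subst finite_image_iff) (simp_all add: inj_on_def infinite_UNIV_int)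
  ultimately show ?thesis by (rule infinite_super)
qed

theorem theorem5:
  fixes A0 K N :: "int^2^2"
  assumes "A0 \<in> UT2" and "K \<in> UT2"
    and "N = K ** K - A0 ** A0"
    and "3 \<odot> A0 + 2 \<odot> K \<noteq> 0"
    and "A0 + K \<noteq> 0"
    and "5 \<odot> A0 + 4 \<odot> K \<noteq> 0"
    and "trace (2 \<odot> A0 + K) \<noteq> 0 \<or> (trace A0 = 0 \<and> trace K = 0)"
  shows "infinite {t::int. t \<noteq> 0 \<and>
    jordan_D_quadruple N {A0 + U t, A0 - U t, 2 \<odot> A0 + 2 \<odot> K, 5 \<odot> A0 + 4 \<odot> K}}"
proof -
  define C where "C = 2 \<odot> A0 + 2 \<odot> K"
  define D where "D = 5 \<odot> A0 + 4 \<odot> K"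
  define Y where "Y = 2 \<odot> A0 + K"
  \<comment> \<open>the values of \<open>U t\<close> at which two of the four matrices coincide or one vanishes\<close>
  define F where "F = {0, A0, - A0, C - A0, A0 - C, D - A0, A0 - D}"
  have UT2: "C \<in> UT2" "D \<in> UT2" "Y \<in> UT2" "A0 + K \<in> UT2" "3 \<odot> (A0 + K) \<in> UT2"
    using assms(1,2) by (simp_all add: C_def D_def Y_def UT2_closed)
  have "C \<noteq> 0"
  proof
    assume "C = 0"
    then have "A0 + K = 0"
      by (auto simp: C_def vec_eq_iff forall_2 mat_scale_def map_matrix_def)
    then show False using assms(5) by simp
  qed
  have "D \<noteq> 0" using assms(6) by (simp add: D_def)
  have "D - C = 3 \<odot> A0 + 2 \<odot> K"
    by (simp add: C_def D_def vec_eq_iff mat_scale_def map_matrix_def)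
  then have "C \<noteq> D" using assms(4) by auto
  have traceC: "trace C = 2 * trace (A0 + K)"
    by (simp add: C_def mat2_entries)
  have "trace D = 5 * trace A0 + 4 * trace K"
    by (simp add: D_def mat2_entries)
  then have "infinite {t. \<exists>s. 2 * s * trace Y = t * trace D}"
    using assms(7) by (intro infinite_repairable) (auto simp: Y_def)
  moreover have "finite (U -` F)"
    using inj_U by (intro finite_vimageI) (simp_all add: F_def)
  ultimately have "infinite ({t. \<exists>s. 2 * s * trace Y = t * trace D} - U -` F)"
    by (rule Diff_infinite_finite[rotated])
  moreover have "t \<noteq> 0 \<and> jordan_D_quadruple N {A0 + U t, A0 - U t, C, D}"
    if t: "t \<in> {t. \<exists>s. 2 * s * trace Y = t * trace D} - U -` F" for t
  proof
    have avoid: "U t \<notin> F" using t by simp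
    have "U 0 = 0" by (simp add: mat2_entries)
    then show "t \<noteq> 0" using avoid by (auto simp: F_def)
    then have "A0 + U t \<noteq> A0 - U t" by (auto simp: mat2_entries)
    obtain s where s: "2 * s * trace Y = t * trace D" using t by auto
    have perturbC: "completes_square N (A0 + U r) C (A0 + K + U r)" for r
      using UT2 completes_square_identities(1)[where A = A0 and K = K] traceC assms(3)
      by (intro completes_square_perturb) (simp_all add: C_def)
    have perturbD: "completes_square N (A0 + U r) D (Y + U s')"
      if "2 * s' * trace Y = r * trace D" for r s'
      using UT2 completes_square_identities(2)[where A = A0 and K = K] that assms(3)
      by (intro completes_square_perturb) (simp_all add: D_def Y_def)
    show "jordan_D_quadruple N {A0 + U t, A0 - U t, C, D}"
    proof (rule jordan_D_quadrupleI)
      show "distinct [A0 + U t, A0 - U t, C, D]"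
        using avoid \<open>A0 + U t \<noteq> A0 - U t\<close> \<open>C \<noteq> D\<close> by (auto simp: F_def algebra_simps)
      show "{A0 + U t, A0 - U t, C, D} \<subseteq> UT2"
        using assms(1) UT2 by (simp add: UT2_closed)
      show "0 \<notin> {A0 + U t, A0 - U t, C, D}"
        using avoid \<open>C \<noteq> 0\<close> \<open>D \<noteq> 0\<close> by (auto simp: F_def add_eq_0_iff)
      show "\<exists>X\<in>UT2. completes_square N (A0 + U t) (A0 - U t) X"
        unfolding assms(3) by (rule bexI[OF completes_square_conjugates assms(2)])
      show "\<exists>X\<in>UT2. completes_square N (A0 + U t) C X"
        by (rule bexI, rule perturbC) (simp add: UT2 UT2_closed)
      show "\<exists>X\<in>UT2. completes_square N (A0 - U t) C X"
        by (rule bexI, rule perturbC[of "- t", unfolded U_minus, simplified])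
          (simp add: UT2 UT2_closed)
      show "\<exists>X\<in>UT2. completes_square N (A0 + U t) D X"
        by (rule bexI, rule perturbD[OF s]) (simp add: UT2 UT2_closed)
      show "\<exists>X\<in>UT2. completes_square N (A0 - U t) D X"
        by (rule bexI, rule perturbD[of "- s" "- t", unfolded U_minus, simplified, OF s])
          (simp add: UT2 UT2_closed)
      show "\<exists>X\<in>UT2. completes_square N C D X"
        unfolding assms(3) C_def D_def
        by (rule bexI, rule completes_square_identities(3), rule UT2(5))
    qed
  qed
  ultimately show ?thesis
    unfolding C_def D_def by (elim infinite_super[rotated]) blast
qed

end
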